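(* For each integer $k > 2$ there is a constant $C_k > 0$ such that for all positive integers $n$ and $r$, \[ s_{kn}(C_{n}^{r}) > \frac{kn}{4}\left[1+\frac{(k-1)^{k-1}}{k^{k}}-\frac{C_k}{n}\right]^{r}. \] (In the paper's notation: $s_{kn}(C_{n}^{r}) > \frac{kn}{4}\left[1+\frac{(k-1)^{k-1}}{k^{k}}-O(\frac{1}{n})\right]^{r}$.)
   Context: For a finite Abelian group $G$ and a positive integer $m$, $s_{m}(G)$ denotes the minimal integer $L$ such that every sequence of $L$ (not necessarily distinct) elements of $G$ contains a subsequence of exactly $m$ terms whose sum is $0$. $C_n$ denotes the cyclic group of order $n$, and $C_n^r$ is the direct product of $r$ copies of $C_n$. *)

theory Defs
  imports Complex_Main "HOL-Algebra.FiniteProduct" "HOL-Algebra.Product_Groups"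
begin

definition has_zero_sum_subseq :: "nat \<Rightarrow> ('a, 'b) monoid_scheme \<Rightarrow> 'a list \<Rightarrow> bool" where
  "has_zero_sum_subseq m G xs \<longleftrightarrow>
     (\<exists>I \<subseteq> {..<length xs}. card I = m \<and> finprod G (\<lambda>i. xs ! i) I = \<one>\<^bsub>G\<^esub>)"

text \<open>
  The invariant \<open>s\<^sub>m(G)\<close> of a finite abelian group, which HOL-Algebra writes multiplicatively.
  Some \<open>L\<close> with the required property exists exactly when the exponent of \<open>G\<close> divides \<open>m\<close>;
  otherwise \<open>zs_const m G\<close> has no meaning.
\<close>

definition zs_const :: "nat \<Rightarrow> ('a, 'b) monoid_scheme \<Rightarrow> nat" where
  "zs_const m G =
     (LEAST L. \<forall>xs. length xs = L \<and> set xs \<subseteq> carrier G \<longrightarrow> has_zero_sum_subseq m G xs)"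

definition cyclic_power :: "nat \<Rightarrow> nat \<Rightarrow> (nat \<Rightarrow> int) monoid" where
  "cyclic_power n r = product_group {..<r} (\<lambda>_. integer_mod_group n)"

end

theory Submission
  imports Defs
begin

text \<open>
  Put \<open>c = (k - 1) ^ (k - 1) / k ^ k\<close> and draw \<open>L\<close> random vectors in \<open>{0,1} ^ r\<close>, each entry being
  1 with odds \<open>c\<close>. A set of \<open>k * n\<close> of them sums to 0 iff in each coordinate the number of ones
  is one of \<open>0, n, \<dots>, k * n\<close>, which has probability \<open>Q / (1 + c) ^ (k * n)\<close> with
  \<open>Q = (\<Sum>j\<le>k. (k * n choose j * n) * c ^ (j * n))\<close>. The value of \<open>c\<close> is the largest for which the
  entropy bound gives \<open>(k * n choose n) * c ^ n \<le> 1\<close> for all \<open>n\<close>; then each summand is at most 1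
  and \<open>Q \<le> k + 1\<close>. Hence the expected number of zero-sum sets is at most
  \<open>(L choose k * n) * ((k + 1) / (1 + c) ^ (k * n)) ^ r\<close>, which is below 1 for
  \<open>L \<le> k * n / 4 * ((1 + c) * (1 - 1 / n)) ^ r\<close>.
\<close>

section \<open>The group C_n^r: coordinatewise sums and exponent\<close>

lemma comm_group_cyclic_power: "comm_group (cyclic_power n r)"
proof -
  interpret group "cyclic_power n r"
    by (simp add: cyclic_power_def)
  show ?thesis
    by unfold_locales (simp add: cyclic_power_def add.commute)
qed

lemma finprod_cyclic_power:
  assumes "finite I" and "f \<in> I \<rightarrow> carrier (cyclic_power n r)" and "t < r"
  shows "finprod (cyclic_power n r) f I t = (\<Sum>i\<in>I. f i t) mod int n"
  using assms(1,2)
proof (induction I rule: finite_induct)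
  case empty
  interpret comm_group "cyclic_power n r" by (rule comm_group_cyclic_power)
  have "finprod (cyclic_power n r) f {} = \<one>\<^bsub>cyclic_power n r\<^esub>" by simp
  with assms(3) show ?case by (simp add: cyclic_power_def)
next
  case (insert a I)
  interpret comm_group "cyclic_power n r" by (rule comm_group_cyclic_power)
  have "finprod (cyclic_power n r) f (insert a I) t
      = (f a \<otimes>\<^bsub>cyclic_power n r\<^esub> finprod (cyclic_power n r) f I) t"
    using insert by (subst finprod_insert) auto
  also have "\<dots> = (f a t + finprod (cyclic_power n r) f I t) mod int n"
    using assms(3) by (simp add: cyclic_power_def)
  also have "\<dots> = (\<Sum>i\<in>insert a I. f i t) mod int n"
    using insert by (simp add: mod_add_right_eq)
  finally show ?case .
qed

lemma finite_carrier_cyclic_power: "n > 0 \<Longrightarrow> finite (carrier (cyclic_power n r))"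
  by (auto simp: cyclic_power_def carrier_integer_mod_group intro!: finite_PiE)

lemma pow_cyclic_power_eq_one:
  assumes x: "x \<in> carrier (cyclic_power n r)" and "n dvd m"
  shows "x [^]\<^bsub>cyclic_power n r\<^esub> m = \<one>\<^bsub>cyclic_power n r\<^esub>"
proof -
  interpret comm_group "cyclic_power n r" by (rule comm_group_cyclic_power)
  have eq: "x [^]\<^bsub>cyclic_power n r\<^esub> m = finprod (cyclic_power n r) (\<lambda>_. x) {..<m}"
    using finprod_const[OF x, of "{..<m}"] by simp
  have "(x [^]\<^bsub>cyclic_power n r\<^esub> m) t = \<one>\<^bsub>cyclic_power n r\<^esub> t" for t
  proof (cases "t < r")
    case True
    have "(x [^]\<^bsub>cyclic_power n r\<^esub> m) t = (int m * x t) mod int n"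
      unfolding eq using x True by (subst finprod_cyclic_power) auto
    also have "\<dots> = 0"
      using \<open>n dvd m\<close> by (simp add: mod_0_imp_dvd)
    finally show ?thesis using True by (simp add: cyclic_power_def)
  next
    \<comment> \<open>Elements of the carrier are extensional functions, so outside
      \<open>{..<r}\<close> both sides take the default value \<open>undefined\<close>.\<close>
    case False
    have "x [^]\<^bsub>cyclic_power n r\<^esub> m \<in> carrier (cyclic_power n r)"
      using x by simp
    with False show ?thesis by (auto simp: cyclic_power_def PiE_iff extensional_def)
  qed
  then show ?thesis by blast
qed

section \<open>Lower bounds on the invariant from explicit sequences\<close>

text \<open>The \<open>LEAST\<close> is attained: by pigeonhole, \<open>m * card (carrier G)\<close>
  elements include some \<open>y\<close> at least \<open>m\<close> times, and \<open>m\<close>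
  copies of \<open>y\<close> multiply to the identity. A longer sequence inherits a zero-sum choice
  from its prefix, so a sequence without one must be shorter than the invariant.\<close>

lemma less_zs_const:
  assumes "comm_group G" and fin: "finite (carrier G)"
    and exponent: "\<And>x. x \<in> carrier G \<Longrightarrow> x [^]\<^bsub>G\<^esub> m = \<one>\<^bsub>G\<^esub>"
    and xs: "set xs \<subseteq> carrier G" "\<not> has_zero_sum_subseq m G xs"
  shows "length xs < zs_const m G"
proof -
  interpret comm_group G by fact
  let ?P = "\<lambda>L. \<forall>ys. length ys = L \<and> set ys \<subseteq> carrier G \<longrightarrow> has_zero_sum_subseq m G ys"
  let ?N = "m * card (carrier G)"
  have card_pos: "card (carrier G) > 0"
    using fin by (auto simp: card_gt_0_iff)
  have "?P ?N"
  proof (intro allI impI)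
    fix ys assume ys: "length ys = ?N \<and> set ys \<subseteq> carrier G"
    then have "(!) ys \<in> {..<length ys} \<rightarrow> carrier G"
      using nth_mem by blast
    from pigeonhole_card[OF this _ fin] obtain y where y: "y \<in> carrier G"
      and "length ys \<le> card ((!) ys -` {y} \<inter> {..<length ys}) * card (carrier G)"
      by auto
    with ys card_pos have "m \<le> card ((!) ys -` {y} \<inter> {..<length ys})"
      by simp
    then obtain I where I: "I \<subseteq> (!) ys -` {y} \<inter> {..<length ys}" "card I = m"
      using obtain_subset_with_card_n by metis
    have "finprod G ((!) ys) I = finprod G (\<lambda>_. y) I"
      using I y by (intro finprod_cong') auto
    also have "\<dots> = \<one>\<^bsub>G\<^esub>"
      using finprod_const[OF y, of I] I exponent[OF y] by simp
    finally show "has_zero_sum_subseq m G ys"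
      using I unfolding has_zero_sum_subseq_def by blast
  qed
  then have P: "?P (zs_const m G)"
    unfolding zs_const_def by (rule LeastI)
  show ?thesis
  proof (rule ccontr)
    assume "\<not> ?thesis"
    then have le: "zs_const m G \<le> length xs" by simp
    let ?ys = "take (zs_const m G) xs"
    have "has_zero_sum_subseq m G ?ys"
      using P xs le set_take_subset[of "zs_const m G" xs] by auto
    then obtain I where I: "I \<subseteq> {..<zs_const m G}" "card I = m"
      and one: "finprod G (\<lambda>i. ?ys ! i) I = \<one>\<^bsub>G\<^esub>"
      using le by (auto simp: has_zero_sum_subseq_def)
    have "finprod G (\<lambda>i. ?ys ! i) I = finprod G (\<lambda>i. xs ! i) I"
      using I le xs by (intro finprod_cong') (auto simp: subset_iff)
    with I le one have "has_zero_sum_subseq m G xs"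
      unfolding has_zero_sum_subseq_def by (intro exI[of _ I]) auto
    with xs show False by simp
  qed
qed

section \<open>Generating functions of subsets weighted by cardinality\<close>

lemma sum_power_card_Pow:
  fixes x :: "'b :: comm_semiring_1"
  assumes "finite U"
  shows "(\<Sum>A\<in>Pow U. x ^ card A) = (1 + x) ^ card U"
  using prod_add[of U "\<lambda>_. x" "\<lambda>_. 1"] assms by (simp add: add.commute)

text \<open>Split \<open>A\<close> into \<open>A - I\<close> and \<open>A \<inter> I\<close>. The
  condition restricts only the second part, so the weight factors; this is independence of the
  entries inside and outside \<open>I\<close>.\<close>

lemma sum_power_card_Pow_Int:
  fixes x :: "'b :: comm_semiring_1"
  assumes U: "finite U" and I: "I \<subseteq> U"
  shows "(\<Sum>A | A \<subseteq> U \<and> P (A \<inter> I). x ^ card A)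
       = (1 + x) ^ (card U - card I) * (\<Sum>B | B \<subseteq> I \<and> P B. x ^ card B)"
proof -
  have "(\<Sum>A | A \<subseteq> U \<and> P (A \<inter> I). x ^ card A)
      = (\<Sum>(D, B)\<in>Pow (U - I) \<times> {B. B \<subseteq> I \<and> P B}. x ^ card D * x ^ card B)"
  proof (rule sum.reindex_bij_witness[where i = "\<lambda>(D, B). D \<union> B" and j = "\<lambda>A. (A - I, A \<inter> I)"])
    fix A assume A: "A \<in> {A. A \<subseteq> U \<and> P (A \<inter> I)}"
    then have "finite A" using U finite_subset by auto
    then have "card A = card (A - I) + card (A \<inter> I)"
      by (metis card_Int_Diff add.commute)
    then show "(case (A - I, A \<inter> I) of (D, B) \<Rightarrow> x ^ card D * x ^ card B) = x ^ card A"
      by (simp add: power_add)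
  next
    fix b assume "b \<in> Pow (U - I) \<times> {B. B \<subseteq> I \<and> P B}"
    then obtain D B where b: "b = (D, B)" "D \<subseteq> U - I" "B \<subseteq> I" "P B" by auto
    then have "(D \<union> B) \<inter> I = B" "(D \<union> B) - I = D" by auto
    then show "(case b of (D, B) \<Rightarrow> D \<union> B) \<in> {A. A \<subseteq> U \<and> P (A \<inter> I)}"
      and "((case b of (D, B) \<Rightarrow> D \<union> B) - I, (case b of (D, B) \<Rightarrow> D \<union> B) \<inter> I) = b"
      using b I by auto
  qed auto
  also have "\<dots> = (\<Sum>D\<in>Pow (U - I). x ^ card D) * (\<Sum>B | B \<subseteq> I \<and> P B. x ^ card B)"
    by (simp add: sum_product sum.cartesian_product)
  also have "(\<Sum>D\<in>Pow (U - I). x ^ card D) = (1 + x) ^ (card U - card I)"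
    using U I by (simp add: sum_power_card_Pow card_Diff_subset finite_subset)
  finally show ?thesis .
qed

lemma sum_power_card_dvd:
  fixes x :: "'b :: comm_semiring_1"
  assumes "finite I" "card I = k * n" "n > 0"
  shows "(\<Sum>B | B \<subseteq> I \<and> n dvd card B. x ^ card B) = (\<Sum>j\<le>k. of_nat ((k * n) choose (j * n)) * x ^ (j * n))"
proof -
  have "{B. B \<subseteq> I \<and> n dvd card B} = (\<Union>j\<le>k. {B. B \<subseteq> I \<and> card B = j * n})" (is "?L = ?R")
  proof
    show "?L \<subseteq> ?R"
    proof
      fix B assume B: "B \<in> ?L"
      then obtain j where j: "card B = j * n" by (metis dvdE mem_Collect_eq mult.commute)
      have "j * n \<le> k * n" using B j assms card_mono[of I B] by auto
      with B j assms show "B \<in> ?R" by auto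
    qed
  qed auto
  then have "(\<Sum>B | B \<subseteq> I \<and> n dvd card B. x ^ card B)
    = (\<Sum>j\<le>k. \<Sum>B | B \<subseteq> I \<and> card B = j * n. x ^ card B)"
    using assms by (simp, subst sum.UNION_disjoint) auto
  also have "\<dots> = (\<Sum>j\<le>k. of_nat ((k * n) choose (j * n)) * x ^ (j * n))"
    using assms by (intro sum.cong) (simp_all add: n_subsets)
  finally show ?thesis .
qed

section \<open>Estimates for binomial coefficients and factorials\<close>

text \<open>A set of size \<open>a + b\<close> can be built by choosing \<open>a\<close> elements
  first and \<open>b\<close> of the remaining ones afterwards.\<close>

lemma binomial_add_le: "n choose (a + b) \<le> (n choose a) * (n choose b)"
proof (cases "a + b \<le> n")
  case True
  have "n choose (a + b) \<le> (n choose (a + b)) * ((a + b) choose a)"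
    by (simp add: Suc_leI)
  also have "\<dots> = (n choose a) * ((n - a) choose b)"
    using choose_mult[of a "a + b" n] True by simp
  also have "\<dots> \<le> (n choose a) * (n choose b)"
    by (simp add: binomial_right_mono)
  finally show ?thesis .
qed (simp add: binomial_eq_0)

text \<open>Reduces the bound on the summands of \<open>Q\<close> with index \<open>j\<close> to the
  case \<open>j = 1\<close>.\<close>

lemma binomial_mult_le_power: "n choose (j * a) \<le> (n choose a) ^ j"
proof (induction j)
  case (Suc j)
  have "n choose (Suc j * a) \<le> (n choose a) * (n choose (j * a))"
    using binomial_add_le[of n a "j * a"] by simp
  also have "\<dots> \<le> (n choose a) * (n choose a) ^ j"
    using Suc by simp
  finally show ?case by simp
qed simp

text \<open>A single term of the binomial expansion of \<open>(1/k + (1 - 1/k)) ^ (k * n)\<close> is at most 1.\<close>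

lemma binomial_mult_le_entropy:
  assumes "k > 0"
  shows "real ((k * n) choose n) * ((real k - 1) ^ (k - 1) / real k ^ k) ^ n \<le> 1"
proof -
  let ?q = "1 / real k"
  have nonneg: "0 \<le> 1 - ?q" using assms by simp
  obtain l where l: "k = Suc l" using assms gr0_conv_Suc by blast
  have "?q ^ n * (1 - ?q) ^ (k * n - n) = (?q * (1 - ?q) ^ (k - 1)) ^ n"
    by (simp only: power_mult_distrib power_mult[symmetric] l) (simp add: mult.commute)
  also have "?q * (1 - ?q) ^ (k - 1) = (real k - 1) ^ (k - 1) / real k ^ k"
    by (simp add: l field_simps power_divide)
  finally have eq: "?q ^ n * (1 - ?q) ^ (k * n - n) = ((real k - 1) ^ (k - 1) / real k ^ k) ^ n" .
  have "real ((k * n) choose n) * ?q ^ n * (1 - ?q) ^ (k * n - n)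
      \<le> (\<Sum>i\<le>k * n. real ((k * n) choose i) * ?q ^ i * (1 - ?q) ^ (k * n - i))"
    using assms nonneg by (intro member_le_sum) auto
  also have "\<dots> = (?q + (1 - ?q)) ^ (k * n)"
    by (rule binomial_ring[symmetric])
  also have "\<dots> = 1" by simp
  finally show ?thesis
    using eq by (simp add: mult.assoc)
qed

lemma sum_binomial_multiples_le:
  assumes "k > 0"
  defines "c \<equiv> (real k - 1) ^ (k - 1) / real k ^ k"
  shows "(\<Sum>j\<le>k. real ((k * n) choose (j * n)) * c ^ (j * n)) \<le> real k + 1"
proof -
  have c: "0 \<le> c" using assms by simp
  have "real ((k * n) choose (j * n)) * c ^ (j * n) \<le> 1" for j
  proof -
    have "real ((k * n) choose (j * n)) * c ^ (j * n) \<le> real (((k * n) choose n) ^ j) * c ^ (j * n)"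
      using c binomial_mult_le_power[of "k * n" j n] by (intro mult_right_mono) auto
    also have "\<dots> = (real ((k * n) choose n) * c ^ n) ^ j"
      by (simp add: power_mult_distrib power_mult[symmetric] mult.commute)
    also have "\<dots> \<le> 1"
      using c binomial_mult_le_entropy[OF assms(1), of n] by (intro power_le_one) (auto simp: c_def)
    finally show ?thesis .
  qed
  then have "(\<Sum>j\<le>k. real ((k * n) choose (j * n)) * c ^ (j * n)) \<le> (\<Sum>j\<le>k. 1)"
    by (intro sum_mono) auto
  then show ?thesis by simp
qed

text \<open>\<open>m ^ m / fact m\<close> is one term of the series for \<open>exp m\<close>, and
  \<open>exp 1 < 4\<close>. This is the origin of the factor \<open>1 / 4\<close> in the
  theorem.\<close>

lemma power_less_fact:
  assumes "m > 0"
  shows "(real m / 4) ^ m < fact m"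
proof -
  have "real m ^ m /\<^sub>R fact m \<le> (\<Sum>i. real m ^ i /\<^sub>R fact i)"
    using sum_le_suminf[OF summable_exp_generic[of "real m"], of "{m}"] by simp
  also have "\<dots> = exp (real m)" by (simp add: exp_def)
  also have "\<dots> = exp 1 ^ m" by (simp add: exp_of_nat_mult[symmetric])
  also have "\<dots> < 4 ^ m"
    using assms exp_le by (intro power_strict_mono) auto
  finally show ?thesis by (simp add: field_simps power_divide)
qed

section \<open>The first-moment argument and its translation to sequences\<close>

text \<open>
  First-moment argument: \<open>A t\<close> is the set of indices whose random vector has a 1 in
  coordinate \<open>t\<close>. All weights are scaled by \<open>(1 + x) ^ (L * r)\<close>, so that the independent
  probability \<open>x / (1 + x)\<close> of an entry 1 becomes the weight \<open>x\<close>.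
\<close>

lemma exists_sets_avoiding_dvd:
  fixes x :: real
  assumes "x \<ge> 0" "n > 0" "k * n \<le> L"
    and less: "real (L choose (k * n)) * (\<Sum>j\<le>k. real ((k * n) choose (j * n)) * x ^ (j * n)) ^ r
        < (1 + x) ^ (k * n * r)"
  shows "\<exists>A. (\<forall>t<r. A t \<subseteq> {..<L}) \<and>
    (\<forall>I\<subseteq>{..<L}. card I = k * n \<longrightarrow> (\<exists>t<r. \<not> n dvd card (A t \<inter> I)))"
proof (rule ccontr)
  assume neg: "\<not> ?thesis"
  define m where "m = k * n"
  define Q where "Q = (\<Sum>j\<le>k. real ((k * n) choose (j * n)) * x ^ (j * n))"
  \<comment> \<open>\<open>F\<close> is the sample space with weight \<open>w\<close>, and
    \<open>B I\<close> is the event that the vectors indexed by \<open>I\<close> sum to zero. The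
    negated claim says that these events cover \<open>F\<close>.\<close>
  define S where "S = {I. I \<subseteq> {..<L} \<and> card I = m}"
  define F where "F = PiE {..<r} (\<lambda>_. Pow {..<L})"
  define B where "B I = PiE {..<r} (\<lambda>_. {A. A \<subseteq> {..<L} \<and> n dvd card (A \<inter> I)})" for I
  define w where "w A = (\<Prod>t<r. x ^ card (A t))" for A :: "nat \<Rightarrow> nat set"
  have finB: "finite (B I)" for I
    unfolding B_def by (intro finite_PiE) auto
  have finS: "finite S" unfolding S_def by simp
  have finF: "finite F"
    unfolding F_def by (intro finite_PiE) auto
  have w: "0 \<le> w A" for A
    unfolding w_def using \<open>x \<ge> 0\<close> by (intro prod_nonneg) auto
  have cover: "F \<subseteq> (\<Union>I\<in>S. B I)"
  proof
    fix A assume A: "A \<in> F"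
    then have "\<forall>t<r. A t \<subseteq> {..<L}" by (auto simp: F_def PiE_iff)
    with spec[OF neg[unfolded not_ex], of A]
    obtain I where "I \<subseteq> {..<L}" "card I = m" "\<forall>t<r. n dvd card (A t \<inter> I)"
      unfolding m_def by auto
    with A show "A \<in> (\<Union>I\<in>S. B I)"
      by (auto simp: F_def B_def S_def PiE_iff)
  qed
  \<comment> \<open>Union bound: sum over pairs \<open>(I, A)\<close> with
    \<open>A \<in> B I\<close>; the projection \<open>snd\<close> hits every
    \<open>A \<in> F\<close>.\<close>
  have "sum w F \<le> (\<Sum>p\<in>Sigma S B. w (snd p))"
  proof (rule sum_le_included[where i = snd])
    show "finite (Sigma S B)" using finS finB by blast
    show "\<forall>A\<in>F. \<exists>p\<in>Sigma S B. snd p = A \<and> w A \<le> w (snd p)"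
    proof
      fix A assume "A \<in> F"
      with cover obtain I where "I \<in> S" "A \<in> B I" by blast
      then show "\<exists>p\<in>Sigma S B. snd p = A \<and> w A \<le> w (snd p)"
        by (intro bexI[of _ "(I, A)"]) auto
    qed
  qed (use finF w in auto)
  also have "\<dots> = (\<Sum>I\<in>S. sum w (B I))"
    using finB finS by (simp add: sum.Sigma case_prod_unfold)
  also have "\<dots> = (\<Sum>I\<in>S. ((1 + x) ^ (L - m) * Q) ^ r)"
  proof (rule sum.cong)
    fix I assume I: "I \<in> S"
    then have "finite I" by (auto simp: S_def finite_subset)
    \<comment> \<open>The coordinates are independent, so the weight of the event is a product of
      \<open>r\<close> equal factors.\<close>
    have "sum w (B I) = (\<Prod>t<r. \<Sum>A | A \<subseteq> {..<L} \<and> n dvd card (A \<inter> I). x ^ card A)"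
      unfolding w_def B_def by (subst prod_sum_PiE) auto
    also have "(\<Sum>A | A \<subseteq> {..<L} \<and> n dvd card (A \<inter> I). x ^ card A) = (1 + x) ^ (L - m) * Q"
      using I \<open>finite I\<close> \<open>n > 0\<close> sum_power_card_Pow_Int[where U = "{..<L}" and P = "\<lambda>B. n dvd card B" and I = I and x = x]
      by (simp add: S_def m_def Q_def sum_power_card_dvd)
    finally show "sum w (B I) = ((1 + x) ^ (L - m) * Q) ^ r" by simp
  qed simp
  also have "\<dots> = real (L choose m) * Q ^ r * (1 + x) ^ ((L - m) * r)"
    by (simp add: S_def n_subsets power_mult_distrib power_mult)
  also have "\<dots> < (1 + x) ^ (m * r) * (1 + x) ^ ((L - m) * r)"
    using less assms by (intro mult_strict_right_mono) (auto simp: m_def Q_def)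
  also have "\<dots> = (1 + x) ^ (L * r)"
    using assms by (simp add: power_add[symmetric] add_mult_distrib[symmetric] m_def)
  \<comment> \<open>\<open>(1 + x) ^ (L * r)\<close> is the total weight of \<open>F\<close>, so the
    chain ends in \<open>sum w F < sum w F\<close>.\<close>
  also have "\<dots> = (\<Prod>t<r. \<Sum>A\<in>Pow {..<L}. x ^ card A)"
    by (simp add: sum_power_card_Pow power_mult)
  also have "\<dots> = sum w F"
    unfolding w_def F_def by (rule prod_sum_PiE) auto
  finally show False by simp
qed

text \<open>The avoiding sets become a sequence of 0-1 vectors: coordinate \<open>t\<close> of a sum
  over \<open>I\<close> is \<open>card (A t \<inter> I)\<close> modulo \<open>n\<close>.\<close>

lemma less_zs_const_cyclic_power:
  fixes x :: real
  assumes "x \<ge> 0" "n > 1" "k > 0"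
    and less: "real (L choose (k * n)) * (\<Sum>j\<le>k. real ((k * n) choose (j * n)) * x ^ (j * n)) ^ r
        < (1 + x) ^ (k * n * r)"
  shows "L < zs_const (k * n) (cyclic_power n r)"
proof -
  let ?G = "cyclic_power n r"
  interpret comm_group ?G by (rule comm_group_cyclic_power)
  have "\<exists>A. (\<forall>t<r. A t \<subseteq> {..<L}) \<and>
    (\<forall>I\<subseteq>{..<L}. card I = k * n \<longrightarrow> (\<exists>t<r. \<not> n dvd card (A t \<inter> I)))"
  proof (cases "k * n \<le> L")
    case True
    then show ?thesis using assms by (intro exists_sets_avoiding_dvd) auto
  next
    case False
    \<comment> \<open>With fewer than \<open>k * n\<close> terms there is nothing to avoid, and
      empty sets serve.\<close>
    then have "card I \<noteq> k * n" if "I \<subseteq> {..<L}" for I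
      using card_mono[OF _ that] by auto
    then show ?thesis by (intro exI[of _ "\<lambda>_. {}"]) auto
  qed
  then obtain A where A: "\<And>I. I \<subseteq> {..<L} \<Longrightarrow> card I = k * n \<Longrightarrow> \<exists>t<r. \<not> n dvd card (A t \<inter> I)"
    by blast
  \<comment> \<open>The restriction to \<open>{..<r}\<close> makes \<open>v i\<close> extensional,
    and \<open>n > 1\<close> makes 1 a valid residue; both are needed for membership in the
    carrier.\<close>
  define v where "v i = (\<lambda>t\<in>{..<r}. if i \<in> A t then 1 else (0::int))" for i :: nat
  have v: "v i \<in> carrier ?G" for i
    using \<open>n > 1\<close> by (auto simp: v_def cyclic_power_def carrier_integer_mod_group)
  have "\<not> has_zero_sum_subseq (k * n) ?G (map v [0..<L])"
  proof
    assume "has_zero_sum_subseq (k * n) ?G (map v [0..<L])"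
    then obtain I where I: "I \<subseteq> {..<L}" "card I = k * n"
      and one: "finprod ?G (\<lambda>i. map v [0..<L] ! i) I = \<one>\<^bsub>?G\<^esub>"
      by (auto simp: has_zero_sum_subseq_def)
    have finI: "finite I" using I finite_subset by blast
    have "finprod ?G (\<lambda>i. map v [0..<L] ! i) I = finprod ?G v I"
      using I v by (intro finprod_cong') auto
    with one have one: "finprod ?G v I = \<one>\<^bsub>?G\<^esub>" by simp
    obtain t where t: "t < r" "\<not> n dvd card (A t \<inter> I)"
      using A I by blast
    have "(\<Sum>i\<in>I. v i t) = int (card (A t \<inter> I))"
      using t finI by (simp add: v_def sum.If_cases Int_commute)
    then have "finprod ?G v I t = int (card (A t \<inter> I)) mod int n"
      using finprod_cyclic_power[of I v n r t] finI v t by auto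
    moreover have "finprod ?G v I t = 0"
      using one t by (simp add: cyclic_power_def)
    ultimately show False
      using t by (metis int_dvd_int_iff mod_0_imp_dvd)
  qed
  then have "length (map v [0..<L]) < zs_const (k * n) ?G"
    using v \<open>n > 1\<close>
    by (intro less_zs_const comm_group_cyclic_power finite_carrier_cyclic_power pow_cyclic_power_eq_one) auto
  then show ?thesis by simp
qed

section \<open>Choice of parameters and conclusion\<close>

text \<open>Since \<open>(1 - 1 / n) ^ n \<le> exp (-1) \<le> 1 / 2\<close> and
  \<open>k + 1 \<le> 2 ^ k\<close>, shrinking the base by \<open>1 - 1 / n\<close> pays for the
  bound \<open>k + 1\<close> on \<open>Q\<close>. This loss is the source of the term
  \<open>C / n\<close>.\<close>

lemma one_minus_inverse_power_le:
  assumes "n > 0"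
  shows "real (k + 1) * (1 - 1 / real n) ^ (k * n) \<le> 1"
proof -
  have "(1 - 1 / real n) ^ n \<le> exp (- 1 / real n) ^ n"
    using assms exp_ge_add_one_self[of "- 1 / real n"] by (intro power_mono) auto
  also have "\<dots> = exp (-1)"
    using assms by (simp add: exp_of_nat_mult[symmetric])
  also have "\<dots> \<le> 1 / 2"
    using exp_ge_add_one_self[of 1] by (simp add: exp_minus field_simps)
  finally have half: "(1 - 1 / real n) ^ n \<le> 1 / 2" .
  have "(1 - 1 / real n) ^ (k * n) = ((1 - 1 / real n) ^ n) ^ k"
    by (simp add: power_mult[symmetric] mult.commute)
  also have "\<dots> \<le> (1 / 2) ^ k"
    using half assms by (intro power_mono) auto
  finally have "real (k + 1) * (1 - 1 / real n) ^ (k * n) \<le> real (k + 1) * (1 / 2) ^ k"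
    by (intro mult_left_mono) auto
  also have "\<dots> \<le> 1"
  proof -
    have "k + 1 \<le> 2 ^ k" by (metis Suc_eq_plus1 Suc_leI less_exp)
    then have "real (k + 1) \<le> 2 ^ k" by (metis of_nat_le_iff of_nat_numeral of_nat_power)
    then show ?thesis by (simp add: field_simps power_divide)
  qed
  finally show ?thesis .
qed

theorem theorem1:
  fixes k :: nat
  assumes "k > 2"
  shows "\<exists>C::real. C > 0 \<and>
    (\<forall>n r :: nat. n > 0 \<longrightarrow> r > 0 \<longrightarrow>
      real (zs_const (k * n) (cyclic_power n r)) >
        real (k * n) / 4 * (1 + (real k - 1) ^ (k - 1) / real k ^ k - C / real n) ^ r)"
proof -
  define c where "c = (real k - 1) ^ (k - 1) / real k ^ k"
  have c: "c \<ge> 0" using assms by (simp add: c_def)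
  \<comment> \<open>Taking \<open>C = 1 + c\<close> turns the base into
    \<open>(1 + c) * (1 - 1 / n)\<close>, which is nonnegative for every
    \<open>n > 0\<close>.\<close>
  have "real (k * n) / 4 * (1 + c - (1 + c) / real n) ^ r < real (zs_const (k * n) (cyclic_power n r))"
    if "n > 0" "r > 0" for n r :: nat
  proof (cases "n = 1")
    case True
    \<comment> \<open>For \<open>n = 1\<close> the base is 0 and \<open>r > 0\<close>, so only
      positivity of the invariant is needed; the empty sequence has no \<open>k\<close> terms to
      select.\<close>
    have "length ([] :: (nat \<Rightarrow> int) list) < zs_const (k * n) (cyclic_power n r)"
      using that assms
      by (intro less_zs_const comm_group_cyclic_power finite_carrier_cyclic_power pow_cyclic_power_eq_one)
        (auto simp: has_zero_sum_subseq_def)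
    with True that show ?thesis by (simp add: zero_power)
  next
    case False
    define m where "m = k * n"
    define X where "X = (1 + c) * (1 - 1 / real n)"
    define L where "L = nat \<lfloor>real m / 4 * X ^ r\<rfloor>"
    define Q where "Q = (\<Sum>j\<le>k. real ((k * n) choose (j * n)) * c ^ (j * n))"
    have m: "m > 0" using that assms by (simp add: m_def)
    have X: "X \<ge> 0" using c that by (simp add: X_def)
    have Q: "0 \<le> Q" "Q \<le> real (k + 1)"
      using sum_binomial_multiples_le[of k n] assms c by (auto simp: Q_def c_def intro!: sum_nonneg)
    have "real (L choose m) * fact m \<le> real L ^ m"
      using binomial_fact_pow[of L m] by (metis of_nat_fact of_nat_le_iff of_nat_mult of_nat_power)
    also have "\<dots> \<le> (real m / 4 * X ^ r) ^ m"
      using X of_nat_floor[of "real m / 4 * X ^ r"] by (intro power_mono) (auto simp: L_def)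
    also have "\<dots> = (real m / 4) ^ m * X ^ (m * r)"
      by (simp only: power_mult_distrib power_mult[symmetric] mult.commute[of r m])
    finally have choose: "real (L choose m) * fact m \<le> (real m / 4) ^ m * X ^ (m * r)" .
    \<comment> \<open>In each coordinate the factor \<open>(1 - 1 / n) ^ m\<close> inside
      \<open>X ^ m\<close> absorbs \<open>Q\<close>.\<close>
    have "X ^ m * Q = (1 + c) ^ m * ((1 - 1 / real n) ^ m * Q)"
      by (simp add: X_def power_mult_distrib)
    also have "\<dots> \<le> (1 + c) ^ m * 1"
    proof (intro mult_left_mono)
      have "(1 - 1 / real n) ^ m * Q \<le> (1 - 1 / real n) ^ m * real (k + 1)"
        using Q that by (intro mult_left_mono) auto
      also have "\<dots> \<le> 1"
        using one_minus_inverse_power_le[of n k] that by (simp add: m_def mult.commute)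
      finally show "(1 - 1 / real n) ^ m * Q \<le> 1" .
    qed (use c in auto)
    finally have "(X ^ m * Q) ^ r \<le> ((1 + c) ^ m) ^ r"
      using X Q by (intro power_mono) auto
    then have XQ: "X ^ (m * r) * Q ^ r \<le> (1 + c) ^ (m * r)"
      by (simp add: power_mult_distrib power_mult)
    have "real (L choose m) * Q ^ r * fact m \<le> (real m / 4) ^ m * (X ^ (m * r) * Q ^ r)"
      using mult_right_mono[OF choose, of "Q ^ r"] Q by (simp add: mult_ac)
    also have "\<dots> \<le> (real m / 4) ^ m * (1 + c) ^ (m * r)"
      using XQ by (intro mult_left_mono) auto
    \<comment> \<open>Strictness in the first-moment condition comes from
      \<open>(m / 4) ^ m < fact m\<close>.\<close>
    also have "\<dots> < fact m * (1 + c) ^ (m * r)"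
      using power_less_fact[OF m] c by (intro mult_strict_right_mono) auto
    finally have "real (L choose m) * Q ^ r < (1 + c) ^ (m * r)"
      by (simp add: mult.commute)
    then have "L < zs_const (k * n) (cyclic_power n r)"
      using c False that assms
      by (intro less_zs_const_cyclic_power[of c]) (auto simp: m_def Q_def)
    \<comment> \<open>Rounding down loses nothing: the invariant is an integer above
      \<open>L\<close>, hence at least \<open>L + 1\<close>.\<close>
    moreover have "real m / 4 * X ^ r < real L + 1"
      unfolding L_def by linarith
    ultimately have "real m / 4 * X ^ r < real (zs_const (k * n) (cyclic_power n r))"
      by linarith
    moreover have "X = 1 + c - (1 + c) / real n"
      by (simp add: X_def algebra_simps)
    ultimately show ?thesis by (simp add: m_def)
  qed
  \<comment> \<open>For \<open>n = 1\<close> the base \<open>1 + c - C / n\<close> must not be below \<open>-1\<close> (consider even \<open>r\<close>), so \<open>C\<close> cannot be taken large.\<close>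
  then show ?thesis
    using c unfolding c_def[symmetric] by (intro exI[of _ "1 + c"]) auto
qed

end
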